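(* Let $N\ge 0$ and let $(P_i,Q_i,C_i)$, $i=1,\dots,N$, be real triples with $P_i,Q_i\ge 0$. (i) If $P_N\ge\dots\ge P_1\ge 0$ and $Q_N\ge\dots\ge Q_1\ge 0$, then the function $T(P_1,\dots,P_N;Q_1,\dots,Q_N;C_1,\dots,C_N)$ built by the vertex operator coincides, at every $(l,m,n)\in\mathbb Z^3$, with the function $T^{(N)}_{l,m,n}$ defined recursively by $T^{(0)}_{l,m,n}=0$ and $$T^{(k)}_{l,m,n}=\max\big(T^{(k-1)}_{l,m,n},\;2\eta_k(l,m,n)+T^{(k-1)}_{l-1,m+1,n}\big)\qquad(1\le k\le N).$$ (ii) The vertex operator maps $N$-soliton solutions to $(N+1)$-soliton solutions: if $(P_{N+1},Q_{N+1},C_{N+1})$ is a further real triple with $P_{N+1},Q_{N+1}\ge0$ and $(P_i-P_j)(Q_i-Q_j)\ge 0$ for all $1\le i,j\le N+1$, then $T=X(P_{N+1},Q_{N+1},C_{N+1})\,T(P_1,\dots,P_N;Q_1,\dots,Q_N;C_1,\dots,C_N)$ satisfies, for all $l,m,n\in\mathbb Z$, $$T_{l,m+1,n}+T_{l+1,m,n+1}=\max\big(T_{l+1,m,n}+T_{l,m+1,n+1}-2R_n,\;T_{l,m,n+1}+T_{l+1,m+1,n}\big).$$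
   Context: $(R_n)_{n\in\mathbb Z}$ is a fixed family of non-negative real numbers. For a real triple $(P_i,Q_i,C_i)$ put $\Omega_{i,n}=\min(Q_i,R_{n-1})$ and $\eta_i(l,m,n)=C_i+lP_i-mQ_i-\sum_{0}^{n}\Omega_{i,d}$ for $l,m,n\in\mathbb Z$, where $\sum_{i}^{j}\Omega_{k,d}$ denotes $\sum_{d=i+1}^{j}\Omega_{k,d}$ if $i<j$, $0$ if $i=j$, and $-\sum_{d=j+1}^{i}\Omega_{k,d}$ if $i>j$. Put $A_{i,j}=\min(P_i,P_j)+\min(Q_i,Q_j)$ and $\boldsymbol A_{k+1}=(A_{k+1,1},\dots,A_{k+1,k})$. The functions $T(\boldsymbol P;\boldsymbol Q;\boldsymbol C)=T(P_1,\dots,P_k;Q_1,\dots,Q_k;C_1,\dots,C_k)$ on $\mathbb Z^3$ (in the variables $(l,m,n)$) and the vertex operator $X$ are defined recursively by $T(;;)=0$ and $$X(P_{k+1},Q_{k+1},C_{k+1})\,T(\boldsymbol P;\boldsymbol Q;\boldsymbol C)=\max\big(T(\boldsymbol P;\boldsymbol Q;\boldsymbol C),\;2\eta_{k+1}+T(\boldsymbol P;\boldsymbol Q;\boldsymbol C-\boldsymbol A_{k+1})\big)=:T(P_1,\dots,P_{k+1};Q_1,\dots,Q_{k+1};C_1,\dots,C_{k+1}),$$ where the parameters of $X$ are required to satisfy $(P_i-P_{k+1})(Q_i-Q_{k+1})\ge 0$ for $i=1,\dots,k$. *)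

theory Defs
  imports Complex_Main
begin

text \<open>
  Triples are given by functions \<open>P Q C :: nat \<Rightarrow> real\<close> of which only the values at the indices
  \<open>1, \<dots>, k\<close> are relevant to a \<open>k\<close>-soliton function. The arguments \<open>l m n\<close> are the lattice
  coordinates.
\<close>

definition oriented_sum :: "(int \<Rightarrow> real) \<Rightarrow> int \<Rightarrow> int \<Rightarrow> real" where
  "oriented_sum f i j =
     (if i < j then \<Sum>d = i + 1..j. f d
      else if i = j then 0
      else - (\<Sum>d = j + 1..i. f d))"

definition Omega :: "(int \<Rightarrow> real) \<Rightarrow> real \<Rightarrow> int \<Rightarrow> real" where
  "Omega R q n = min q (R (n - 1))"

definition eta :: "(int \<Rightarrow> real) \<Rightarrow> real \<Rightarrow> real \<Rightarrow> real \<Rightarrow> int \<Rightarrow> int \<Rightarrow> int \<Rightarrow> real" where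
  "eta R p q c l m n = c + of_int l * p - of_int m * q - oriented_sum (Omega R q) 0 n"

type_synonym tau = "(nat \<Rightarrow> real) \<Rightarrow> (nat \<Rightarrow> real) \<Rightarrow> (nat \<Rightarrow> real) \<Rightarrow> int \<Rightarrow> int \<Rightarrow> int \<Rightarrow> real"

text \<open>
  The vertex operator \<open>X(p,q,c)\<close> uses the values of \<open>T(P;Q;C)\<close> at shifted phases \<open>C\<close>, so it acts
  on \<open>T\<close> as a function of \<open>P\<close>, \<open>Q\<close>, \<open>C\<close> as well as of the lattice point. It is defined
  for all parameters; the requirement \<open>(P i - p) * (Q i - q) \<ge> 0\<close> for \<open>i = 1, \<dots>, k\<close> on its
  parameters is not built into the definition. The shift of \<open>C i\<close> for \<open>i\<close> outside
  \<open>{1..k}\<close> has no effect, since the \<open>k\<close>-soliton function does not depend on these values.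
\<close>

definition vertex_op :: "(int \<Rightarrow> real) \<Rightarrow> real \<Rightarrow> real \<Rightarrow> real \<Rightarrow> tau \<Rightarrow> tau" where
  "vertex_op R p q c T P Q C l m n =
     max (T P Q C l m n)
         (2 * eta R p q c l m n + T P Q (\<lambda>i. C i - (min p (P i) + min q (Q i))) l m n)"

primrec vertex_T :: "(int \<Rightarrow> real) \<Rightarrow> nat \<Rightarrow> tau" where
  "vertex_T R 0 = (\<lambda>P Q C l m n. 0)"
| "vertex_T R (Suc k) =
     (\<lambda>P Q C. vertex_op R (P (Suc k)) (Q (Suc k)) (C (Suc k)) (vertex_T R k) P Q C)"

primrec rec_T ::
  "(int \<Rightarrow> real) \<Rightarrow> (nat \<Rightarrow> real) \<Rightarrow> (nat \<Rightarrow> real) \<Rightarrow> (nat \<Rightarrow> real) \<Rightarrow> nat \<Rightarrow> int \<Rightarrow> int \<Rightarrow> int \<Rightarrow> real"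
where
  "rec_T R P Q C 0 = (\<lambda>l m n. 0)"
| "rec_T R P Q C (Suc k) =
     (\<lambda>l m n. max (rec_T R P Q C k l m n)
        (2 * eta R (P (Suc k)) (Q (Suc k)) (C (Suc k)) l m n + rec_T R P Q C k (l - 1) (m + 1) n))"

end

theory Submission
  imports Defs "HOL-Library.Function_Algebras"
begin

text \<open>
  If \<open>P\<close> and \<open>Q\<close> are comonotone then \<open>min (P i) (P j) + min (Q i) (Q j)\<close> is the minimum of
  \<open>P i + Q i\<close> and \<open>P j + Q j\<close>. With \<open>d = 2 (P + Q)\<close> and \<open>y = 2 \<eta>\<close> the \<open>N\<close>-soliton function \<open>F\<close> is
  therefore the maximum over \<open>S \<subseteq> {1..N}\<close> of \<open>\<Sum>y i\<close> over \<open>i \<in> S\<close> minus \<open>\<Sum>min (d i) (d j)\<close>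
  over pairs in \<open>S\<close>. This does not depend on the order of the solitons, so an index \<open>k\<close> with
  maximal \<open>d k\<close> may be split off: \<open>F\<close> and \<open>y k\<close> plus a translate of \<open>F\<close> by \<open>- d\<close> compete for
  the maximum. Expanding the bilinear equation in this way, the terms of order \<open>0\<close> and \<open>2\<close> in \<open>y k\<close>
  agree by induction. If \<open>2 R n < q k\<close>, where \<open>q = 2 Q\<close>, both sides contain the same term of order
  \<open>1\<close>, and it dominates the others because the increments of \<open>F\<close> along \<open>d\<close>-monotone non-negative
  directions grow in such directions and drop by a bounded amount under translation by \<open>- d\<close>.
  If \<open>q k \<le> 2 R n\<close>, the shifts in \<open>m\<close> and \<open>n\<close> coincide and the same bound gives the equation
  directly.
\<close>

section \<open>Subset formula for soliton functions and its recursion\<close>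

text \<open>The double sum runs over ordered pairs, hence the division by 2.\<close>

definition tau_set :: "(nat \<Rightarrow> real) \<Rightarrow> nat set \<Rightarrow> (nat \<Rightarrow> real) \<Rightarrow> real" where
  "tau_set d J y =
     Max ((\<lambda>S. (\<Sum>i\<in>S. y i) - (\<Sum>i\<in>S. \<Sum>j\<in>S - {i}. min (d i) (d j)) / 2) ` Pow J)"

abbreviation mono_along :: "(nat \<Rightarrow> real) \<Rightarrow> nat set \<Rightarrow> (nat \<Rightarrow> real) \<Rightarrow> bool" where
  "mono_along d J \<equiv> monotone_on J (\<lambda>i j. d i \<le> d j) (\<le>)"

lemma tau_set_empty [simp]: "tau_set d {} y = 0"
  by (simp add: tau_set_def)

lemma tau_set_cong:
  assumes "\<And>i. i \<in> J \<Longrightarrow> x i = y i"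
  shows "tau_set d J x = tau_set d J y"
proof -
  have "(\<Sum>i\<in>S. x i) = (\<Sum>i\<in>S. y i)" if "S \<in> Pow J" for S
    using that assms by (intro sum.cong) auto
  then show ?thesis
    unfolding tau_set_def by (intro arg_cong[where f = Max] image_cong) auto
qed

lemma tau_set_insert:
  assumes "finite J" "k \<notin> J"
  shows "tau_set d (insert k J) y =
    max (tau_set d J y) (y k + tau_set d J (\<lambda>i. y i - min (d k) (d i)))"
proof -
  define E where "E y S =
    (\<Sum>i\<in>S. y i) - (\<Sum>i\<in>S. \<Sum>j\<in>S - {i}. min (d i) (d j)) / 2" for y S
  have E_insert: "E y (insert k S) = E (\<lambda>i. y i - min (d k) (d i)) S + y k" if "S \<in> Pow J" for S
  proof -
    from that assms have S: "finite S" "k \<notin> S" by (auto intro: finite_subset)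
    have "(\<Sum>j\<in>insert k S - {i}. min (d i) (d j)) =
        min (d k) (d i) + (\<Sum>j\<in>S - {i}. min (d i) (d j))" if "i \<in> S" for i
    proof -
      from that S have "insert k S - {i} = insert k (S - {i})" by auto
      with S show ?thesis by (simp add: min.commute)
    qed
    \<comment> \<open>Each pair of \<open>k\<close> with an \<open>i\<close> in \<open>S\<close>
      occurs in both orders; the factor 2 cancels the halving.\<close>
    then have "(\<Sum>i\<in>insert k S. \<Sum>j\<in>insert k S - {i}. min (d i) (d j)) =
        2 * (\<Sum>i\<in>S. min (d k) (d i)) + (\<Sum>i\<in>S. \<Sum>j\<in>S - {i}. min (d i) (d j))"
      using S by (simp add: sum.distrib)
    with S show ?thesis
      by (simp add: E_def sum_subtractf add_divide_distrib)
  qed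
  have "E y ` Pow (insert k J) =
      E y ` Pow J \<union> (\<lambda>S. E (\<lambda>i. y i - min (d k) (d i)) S + y k) ` Pow J"
    using E_insert by (simp add: Pow_insert image_Un image_image)
  moreover have "Max ((\<lambda>S. E (\<lambda>i. y i - min (d k) (d i)) S + y k) ` Pow J) =
      Max (E (\<lambda>i. y i - min (d k) (d i)) ` Pow J) + y k"
    using assms by (intro Max_add_commute) auto
  ultimately have "Max (E y ` Pow (insert k J)) =
      max (Max (E y ` Pow J)) (y k + Max (E (\<lambda>i. y i - min (d k) (d i)) ` Pow J))"
    using assms by (simp only: Max_Un finite_imageI finite_Pow_iff image_is_empty Pow_not_empty
        not_False_eq_True add.commute)
  then show ?thesis
    by (simp add: tau_set_def E_def)
qed

lemma tau_set_insert_max: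
  assumes "finite J" "k \<notin> J" "\<And>i. i \<in> J \<Longrightarrow> d i \<le> d k"
  shows "tau_set d (insert k J) y = max (tau_set d J y) (y k + tau_set d J (y - d))"
proof -
  have "tau_set d J (\<lambda>i. y i - min (d k) (d i)) = tau_set d J (y - d)"
    using assms(3) by (intro tau_set_cong) (auto simp: min_absorb2)
  then show ?thesis
    using assms by (simp add: tau_set_insert)
qed

section \<open>Inequalities for increments along monotone directions\<close>

lemma tau_set_increment_bound:
  assumes "finite J" "mono_along d J u" "\<And>i. i \<in> J \<Longrightarrow> 0 \<le> u i"
    and "\<And>i. i \<in> J \<Longrightarrow> u i \<le> b" "0 \<le> b"
  shows "tau_set d J (a + u) + tau_set d J (a - d) \<le> tau_set d J a + tau_set d J (a - d + u) + b"
  using assms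
proof (induction J arbitrary: a b rule: finite_ranking_induct[where f = d])
  case empty
  then show ?case by simp
next
  case (insert k J)
  show ?case
  \<comment> \<open>The ranking induction does not guarantee that the inserted index is new.\<close>
  proof (cases "k \<in> J")
    case True
    with insert.prems insert.IH show ?thesis by (simp add: insert_absorb)
  next
    case False
    have mono: "mono_along d J u"
      using insert.prems(1) by (rule monotone_on_subset) auto
    have IH: "tau_set d J (a + u) + tau_set d J (a - d)
        \<le> tau_set d J a + tau_set d J (a - d + u) + b"
      if "\<And>i. i \<in> J \<Longrightarrow> u i \<le> b" "0 \<le> b" for a b
      using insert.IH mono insert.prems that by blast
    have uk: "u i \<le> u k" if "i \<in> J" for i
      using insert.hyps(2) that by (intro monotone_onD[OF insert.prems(1)]) auto
    have k: "0 \<le> u k" "u k \<le> b"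
      using insert.prems by auto
    \<comment> \<open>Since \<open>u\<close> is monotone along \<open>d\<close>, the sharp constant
      \<open>u k\<close> is admissible on \<open>J\<close>. If the left maxima are attained without
      \<open>k\<close> at \<open>a + u\<close> and with \<open>k\<close> at \<open>a - d\<close>,
      the first two bounds add up, telescoping through \<open>a - d\<close>; each other case needs a
      single bound.\<close>
    have bounds: "tau_set d J (a + u) + tau_set d J (a - d)
        \<le> tau_set d J a + tau_set d J (a - d + u) + u k"
      "tau_set d J (a - d + u) + tau_set d J (a - d - d)
        \<le> tau_set d J (a - d) + tau_set d J (a - d - d + u) + b"
      "u k \<le> b"
      using IH[of "u k" a] IH[of b "a - d"] uk k insert.prems(3,4) by auto
    have rec: "tau_set d (insert k J) x = max (tau_set d J x) (x k + tau_set d J (x - d))" for x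
      using insert.hyps False by (intro tau_set_insert_max) auto
    have comm: "a - d - d + u = a + u - d - d" "a - d + u - d = a + u - d - d"
      "a - d + u = a + u - d"
      by (simp_all add: algebra_simps)
    show "tau_set d (insert k J) (a + u) + tau_set d (insert k J) (a - d)
        \<le> tau_set d (insert k J) a + tau_set d (insert k J) (a - d + u) + b"
      using bounds unfolding rec comm plus_fun_apply[of _ _ k] minus_apply[of _ _ k] by linarith
  qed
qed

text \<open>After splitting off a maximal \<open>k\<close>, the pure cases are the induction
  hypothesis at \<open>a\<close> and \<open>a - d\<close>. In a mixed case the hypothesis at
  \<open>a - d\<close> is added to the increment bound for \<open>u\<close> or \<open>w\<close>,
  whose constant \<open>u k\<close> or \<open>w k\<close> is supplied by the \<open>k\<close>-term
  at \<open>a + u + w\<close>.\<close>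

lemma tau_set_supermodular:
  assumes "finite J" "mono_along d J u" "\<And>i. i \<in> J \<Longrightarrow> 0 \<le> u i"
    and "mono_along d J w" "\<And>i. i \<in> J \<Longrightarrow> 0 \<le> w i"
  shows "tau_set d J (a + u) + tau_set d J (a + w) \<le> tau_set d J a + tau_set d J (a + u + w)"
  using assms
proof (induction J arbitrary: a rule: finite_ranking_induct[where f = d])
  case empty
  then show ?case by simp
next
  case (insert k J)
  show ?case
  proof (cases "k \<in> J")
    case True
    with insert.prems insert.IH show ?thesis by (simp add: insert_absorb)
  next
    case False
    have mono: "mono_along d J u" "mono_along d J w"
      using insert.prems(1,3) by (auto elim: monotone_on_subset)
    have IH: "tau_set d J (a + u) + tau_set d J (a + w)
        \<le> tau_set d J a + tau_set d J (a + u + w)" for a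
      using insert.IH mono insert.prems by blast
    have bound: "tau_set d J (a + v) + tau_set d J (a - d)
        \<le> tau_set d J a + tau_set d J (a - d + v) + v k"
      if "mono_along d (insert k J) v" "\<And>i. i \<in> insert k J \<Longrightarrow> 0 \<le> v i" for v
    proof (rule tau_set_increment_bound)
      show "mono_along d J v"
        using that(1) by (rule monotone_on_subset) auto
      show "v i \<le> v k" if "i \<in> J" for i
        using insert.hyps(2) that by (intro monotone_onD[OF \<open>mono_along d (insert k J) v\<close>]) auto
    qed (use that insert.hyps in auto)
    have rec: "tau_set d (insert k J) x = max (tau_set d J x) (x k + tau_set d J (x - d))" for x
      using insert.hyps False by (intro tau_set_insert_max) auto
    have comm: "a - d + u = a + u - d" "a - d + w = a + w - d" "a - d + u + w = a + u + w - d"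
      "a + u - d + w = a + u + w - d"
      by (simp_all add: algebra_simps)
    show "tau_set d (insert k J) (a + u) + tau_set d (insert k J) (a + w)
        \<le> tau_set d (insert k J) a + tau_set d (insert k J) (a + u + w)"
      using IH[of a] IH[of "a - d"] bound[OF insert.prems(1,2)] bound[OF insert.prems(3,4)]
      unfolding rec comm plus_fun_apply[of _ _ k] minus_apply[of _ _ k] by linarith
  qed
qed

lemma tau_set_increment_bound_shifted:
  assumes "finite J" "mono_along d J u" "\<And>i. i \<in> J \<Longrightarrow> 0 \<le> u i"
    and "\<And>i. i \<in> J \<Longrightarrow> u i \<le> b" "0 \<le> b"
    and "mono_along d J w" "\<And>i. i \<in> J \<Longrightarrow> 0 \<le> w i"
  shows "tau_set d J (a + u) + tau_set d J (a - d + w)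
    \<le> tau_set d J a + tau_set d J (a - d + u + w) + b"
  using tau_set_increment_bound[of J d u b a] tau_set_supermodular[of J d u w "a - d"] assms
  by fastforce

section \<open>The bilinear equation for \<open>tau_set\<close>\<close>

lemma tau_set_bilinear:
  fixes p q y :: "nat \<Rightarrow> real" and r :: real
  defines "\<omega> \<equiv> (\<lambda>i. min (q i) r)"
  assumes "finite J" "mono_along (p + q) J p" "mono_along (p + q) J q"
    and "\<And>i. i \<in> J \<Longrightarrow> 0 \<le> p i" "\<And>i. i \<in> J \<Longrightarrow> 0 \<le> q i" "0 \<le> r"
  shows "tau_set (p + q) J (y - q) + tau_set (p + q) J (y + p - \<omega>) =
    max (tau_set (p + q) J (y + p) + tau_set (p + q) J (y - q - \<omega>) - r)
        (tau_set (p + q) J (y - \<omega>) + tau_set (p + q) J (y + p - q))"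
  using assms(2-)
proof (induction J arbitrary: y rule: finite_ranking_induct[where f = "p + q"])
  case empty
  then show ?case by simp
next
  case (insert k J)
  show ?case
  proof (cases "k \<in> J")
    case True
    with insert.prems insert.IH show ?thesis by (simp add: insert_absorb)
  next
    case new: False
    let ?F = "tau_set (p + q)"
    have le_k: "p i \<le> p k" "q i \<le> q k" if "i \<in> insert k J" for i
      using insert.hyps(2) that
      by (auto intro!: monotone_onD[OF insert.prems(1)] monotone_onD[OF insert.prems(2)])
    show "?F (insert k J) (y - q) + ?F (insert k J) (y + p - \<omega>) =
      max (?F (insert k J) (y + p) + ?F (insert k J) (y - q - \<omega>) - r)
          (?F (insert k J) (y - \<omega>) + ?F (insert k J) (y + p - q))"
    proof (cases "q k \<le> r")
      case True
      have \<omega>: "\<omega> i = q i" if "i \<in> insert k J" for i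
        using le_k[OF that] True by (simp add: \<omega>_def)
      have "?F (insert k J) (x - \<omega>) = ?F (insert k J) (x - q)" for x
        using \<omega> by (intro tau_set_cong) simp
      moreover have "?F (insert k J) (y + p) + ?F (insert k J) (y - q - q)
          \<le> ?F (insert k J) (y - q) + ?F (insert k J) (y + p - q) + r"
        using tau_set_increment_bound[of "insert k J" "p + q" q r "y + p - q"] insert.prems
          insert.hyps(1) le_k(2) True
        by (force simp: algebra_simps)
      ultimately show ?thesis
        by (simp add: max_def)
    next
      case False
      have mono: "mono_along (p + q) J p" "mono_along (p + q) J q"
        using insert.prems(1,2) by (auto elim: monotone_on_subset)
      have IH: "?F J (y - q) + ?F J (y + p - \<omega>) =
        max (?F J (y + p) + ?F J (y - q - \<omega>) - r) (?F J (y - \<omega>) + ?F J (y + p - q))" for y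
        using insert.IH mono insert.prems by blast
      note pos = insert.prems(3,4)[OF insertI2] insert.prems(5)
      have \<omega>k: "\<omega> k = r"
        using False by (simp add: \<omega>_def)
      have \<omega>: "0 \<le> \<omega> i" "\<omega> i \<le> q i" "\<omega> i \<le> r" "q i - \<omega> i \<le> q k - r" if "i \<in> J" for i
        using that le_k(2)[of i] False pos by (auto simp: \<omega>_def)
      \<comment> \<open>Here \<open>q - \<omega>\<close> is the positive part of
        \<open>q - r\<close>, so it grows with \<open>q\<close>.\<close>
      have mono_d: "mono_along (p + q) J (p + q - \<omega>)" "mono_along (p + q) J (p + q + \<omega>)"
          "mono_along (p + q) J (q - \<omega>)"
        using mono by (fastforce simp: monotone_on_def \<omega>_def)+
      note bound = tau_set_increment_bound_shifted[where d = "p + q", OF insert.hyps(1)]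
      \<comment> \<open>The common term of order 1 is
        \<open>y k + p k - r + ?F J (y - q) + ?F J (y - q - \<omega>)\<close>. The facts
        \<open>a\<close> to \<open>d\<close> bound the other order-1 terms by it: \<open>a\<close>
        the one on the left, \<open>b\<close> the one in the first entry of the maximum,
        \<open>c\<close> and \<open>d\<close> those in the second.\<close>
      have a: "?F J (y - q - (p + q)) + ?F J (y + p - \<omega>)
          \<le> ?F J (y - q) + ?F J (y - q - \<omega>) + (p k + q k - r)"
      proof -
        have eqs: "y - q + (p + q - \<omega>) = y + p - \<omega>" "y - q - (p + q) + (p + q - \<omega>) = y - q - \<omega>"
          by simp_all
        show ?thesis
          using tau_set_increment_bound[OF insert.hyps(1) mono_d(1), of "p k + q k - r" "y - q"]
            \<omega> le_k pos insert.prems False unfolding eqs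
          by (smt (verit) insertI1 insertI2 fun_diff_def plus_fun_apply)
      qed
      have b: "?F J (y + p) + ?F J (y - q - \<omega> - (p + q))
          \<le> ?F J (y - q) + ?F J (y - q - \<omega>) + (p k + q k + r)"
      proof -
        have eqs: "y - q - \<omega> + (p + q + \<omega>) = y + p" "y - q - \<omega> - (p + q) + (p + q + \<omega>) = y - q"
          by simp_all
        show ?thesis
          using tau_set_increment_bound[OF insert.hyps(1) mono_d(2), of "p k + q k + r" "y - q - \<omega>"]
            \<omega> le_k pos insert.prems False unfolding eqs
          by (smt (verit) insertI1 insertI2 plus_fun_apply)
      qed
      have c: "?F J (y + p - q) + ?F J (y - \<omega> - (p + q))
          \<le> ?F J (y - q) + ?F J (y - q - \<omega>) + p k"
      proof -
        have eqs: "y - q + p = y + p - q" "y - q - (p + q) + (q - \<omega>) = y - \<omega> - (p + q)"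
          "y - q - (p + q) + p + (q - \<omega>) = y - q - \<omega>"
          by simp_all
        show ?thesis
          using bound[OF mono(1) _ _ _ mono_d(3), of "p k" "y - q"]
            \<omega> le_k pos insert.prems unfolding eqs
          by simp
      qed
      have d: "?F J (y - \<omega>) + ?F J (y - q - q)
          \<le> ?F J (y - q) + ?F J (y - q - \<omega>) + (q k - r)"
      proof -
        have eqs: "y - q + (q - \<omega>) = y - \<omega>" "y - q - (p + q) + p = y - q - q"
          "y - q - (p + q) + (q - \<omega>) + p = y - q - \<omega>"
          by simp_all
        show ?thesis
          using bound[OF mono_d(3) _ _ _ mono(1), of "q k - r" "y - q"]
            \<omega> le_k pos insert.prems False unfolding eqs
          by simp
      qed
      \<comment> \<open>Translation by \<open>- (p + q)\<close> turns a shift by \<open>p\<close>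
        into one by \<open>- q\<close>; this makes the order-1 terms coincide.\<close>
      have shifts: "y + p - (p + q) = y - q" "y + p - \<omega> - (p + q) = y - q - \<omega>"
        "y + p - q - (p + q) = y - q - q" "y - (p + q) - q = y - q - (p + q)"
        "y - (p + q) + p = y - q" "y - (p + q) - \<omega> = y - \<omega> - (p + q)"
        "y - q - (p + q) - \<omega> = y - q - \<omega> - (p + q)"
        by (simp_all add: algebra_simps)
      have rec: "?F (insert k J) x = max (?F J x) (x k + ?F J (x - (p + q)))" for x
        using insert.hyps new by (intro tau_set_insert_max) auto
      show ?thesis
        using IH[of y] IH[of "y - (p + q)"] a b c d
        unfolding rec shifts plus_fun_apply[of _ _ k] minus_apply[of _ _ k] \<omega>k by linarith
    qed
  qed
qed

section \<open>From \<open>tau_set\<close> to the soliton functions\<close>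

lemma oriented_sum_plus1: "oriented_sum f 0 (n + 1) = oriented_sum f 0 n + f (n + 1)"
proof -
  consider "n \<ge> 0" | "n = -1" | "n < -1" by linarith
  then show ?thesis
  proof cases
    case 1
    then have "{1..n + 1} = insert (n + 1) {1..n}" by auto
    with 1 show ?thesis by (auto simp: oriented_sum_def)
  next
    case 2
    then show ?thesis by (simp add: oriented_sum_def)
  next
    case 3
    then have "{n + 1..0} = insert (n + 1) {n + 1 + 1..0}" by auto
    with 3 show ?thesis by (simp add: oriented_sum_def)
  qed
qed

text \<open>Both differences have the same weak sign, so the sign of their sum decides both.\<close>

lemma comonotone_imp_mono_along:
  fixes P Q :: "nat \<Rightarrow> real"
  assumes "\<And>i j. i \<in> J \<Longrightarrow> j \<in> J \<Longrightarrow> (P i - P j) * (Q i - Q j) \<ge> 0"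
  shows "mono_along (P + Q) J P" "mono_along (P + Q) J Q"
proof -
  have "P i \<le> P j \<and> Q i \<le> Q j" if "i \<in> J" "j \<in> J" "P i + Q i \<le> P j + Q j" for i j
    using assms[OF that(1,2)] that(3) by (auto simp: zero_le_mult_iff)
  then show "mono_along (P + Q) J P" "mono_along (P + Q) J Q"
    by (auto simp: monotone_on_def)
qed

text \<open>The new soliton need not be the largest, so the general \<open>tau_set_insert\<close> is
  used; \<open>C\<close> is arbitrary in the induction because the operator shifts phases.\<close>

lemma vertex_T_eq_tau_set:
  assumes "mono_along (P + Q) {1..k} P" "mono_along (P + Q) {1..k} Q"
  shows "vertex_T R k P Q C l m n =
    tau_set (\<lambda>i. 2 * (P i + Q i)) {1..k} (\<lambda>i. 2 * eta R (P i) (Q i) (C i) l m n)"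
  using assms
proof (induction k arbitrary: C)
  case 0
  then show ?case by simp
next
  case (Suc k)
  have "mono_along (P + Q) {1..k} P" "mono_along (P + Q) {1..k} Q"
    using Suc.prems by (auto elim: monotone_on_subset)
  note IH = Suc.IH[OF this]
  have min_add: "2 * (min (P (Suc k)) (P i) + min (Q (Suc k)) (Q i)) =
      min (2 * (P (Suc k) + Q (Suc k))) (2 * (P i + Q i))" if "i \<in> {1..k}" for i
    using that monotone_onD[OF Suc.prems(1), of i "Suc k"] monotone_onD[OF Suc.prems(1), of "Suc k" i]
      monotone_onD[OF Suc.prems(2), of i "Suc k"] monotone_onD[OF Suc.prems(2), of "Suc k" i]
    by (auto simp: min_def)
  have "{1..Suc k} = insert (Suc k) {1..k}" by auto
  moreover have "tau_set (\<lambda>i. 2 * (P i + Q i)) {1..k}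
      (\<lambda>i. 2 * eta R (P i) (Q i) (C i - (min (P (Suc k)) (P i) + min (Q (Suc k)) (Q i))) l m n) =
    tau_set (\<lambda>i. 2 * (P i + Q i)) {1..k}
      (\<lambda>i. 2 * eta R (P i) (Q i) (C i) l m n - min (2 * (P (Suc k) + Q (Suc k))) (2 * (P i + Q i)))"
    using min_add by (intro tau_set_cong) (simp add: eta_def algebra_simps)
  ultimately show ?case
    by (simp add: vertex_op_def IH tau_set_insert)
qed

text \<open>Moving to \<open>(l - 1, m + 1)\<close> lowers each \<open>2 * eta\<close> by
  \<open>2 * (P i + Q i)\<close>, which is the translation by \<open>- d\<close> because sorting
  makes the last index maximal.\<close>

lemma rec_T_eq_tau_set:
  assumes "mono_on {1..k} P" "mono_on {1..k} Q"
  shows "rec_T R P Q C k l m n =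
    tau_set (\<lambda>i. 2 * (P i + Q i)) {1..k} (\<lambda>i. 2 * eta R (P i) (Q i) (C i) l m n)"
  using assms
proof (induction k arbitrary: l m)
  case 0
  then show ?case by simp
next
  case (Suc k)
  have "mono_on {1..k} P" "mono_on {1..k} Q"
    using Suc.prems by (auto elim: monotone_on_subset)
  note IH = Suc.IH[OF this]
  let ?d = "\<lambda>i. 2 * (P i + Q i)" and ?y = "\<lambda>i. 2 * eta R (P i) (Q i) (C i) l m n"
  have "?d i \<le> ?d (Suc k)" if "i \<in> {1..k}" for i
    using that mono_onD[OF Suc.prems(1), of i "Suc k"] mono_onD[OF Suc.prems(2), of i "Suc k"]
    by simp
  then have "tau_set ?d (insert (Suc k) {1..k}) ?y =
      max (tau_set ?d {1..k} ?y) (?y (Suc k) + tau_set ?d {1..k} (?y - ?d))"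
    by (intro tau_set_insert_max) auto
  moreover have "(\<lambda>i. 2 * eta R (P i) (Q i) (C i) (l - 1) (m + 1) n) = ?y - ?d"
    by (simp add: fun_eq_iff eta_def algebra_simps)
  moreover have "{1..Suc k} = insert (Suc k) {1..k}" by auto
  ultimately show ?case
    by (simp only: rec_T.simps IH)
qed

lemma vertex_T_bilinear:
  assumes "\<forall>n. R n \<ge> 0" "\<forall>i\<in>{1..k}. P i \<ge> 0 \<and> Q i \<ge> 0"
    and "mono_along (P + Q) {1..k} P" "mono_along (P + Q) {1..k} Q"
  shows "vertex_T R k P Q C l (m + 1) n + vertex_T R k P Q C (l + 1) m (n + 1) =
    max (vertex_T R k P Q C (l + 1) m n + vertex_T R k P Q C l (m + 1) (n + 1) - 2 * R n)
        (vertex_T R k P Q C l m (n + 1) + vertex_T R k P Q C (l + 1) (m + 1) n)"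
proof -
  define p q where "p = (\<lambda>i. 2 * P i)" and "q = (\<lambda>i. 2 * Q i)"
  define \<omega> where "\<omega> = (\<lambda>i. min (q i) (2 * R n))"
  define y where "y l m n = (\<lambda>i. 2 * eta R (P i) (Q i) (C i) l m n)" for l m n
  have y: "y (l + 1) m n = y l m n + p" "y l (m + 1) n = y l m n - q" for l m n
    by (auto simp: fun_eq_iff y_def p_def q_def eta_def algebra_simps)
  \<comment> \<open>The step from \<open>n\<close> to \<open>n + 1\<close> adds \<open>Omega\<close>
    at \<open>n + 1\<close>, which reads \<open>R n\<close>.\<close>
  have y_n: "y l m (n + 1) = y l m n - \<omega>" for l m
    by (simp add: fun_eq_iff y_def q_def \<omega>_def eta_def oriented_sum_plus1 Omega_def min_def)
  have T: "vertex_T R k P Q C l m n = tau_set (p + q) {1..k} (y l m n)" for l m n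
  proof -
    have "(\<lambda>i. 2 * (P i + Q i)) = p + q"
      by (simp add: fun_eq_iff p_def q_def)
    with vertex_T_eq_tau_set[OF assms(3,4)] show ?thesis
      by (simp add: y_def)
  qed
  have "mono_along (p + q) {1..k} p" "mono_along (p + q) {1..k} q"
    using assms(3,4) by (auto simp: monotone_on_def p_def q_def)
  then show ?thesis
    using tau_set_bilinear[of "{1..k}" p q "2 * R n" "y l m n"] assms(1,2)
    by (simp add: T y y_n \<omega>_def p_def q_def)
qed

theorem mainTheorem2:
  fixes R :: "int \<Rightarrow> real" and N :: nat and P Q C :: "nat \<Rightarrow> real"
  assumes "\<forall>n. R n \<ge> 0"
    and "\<forall>i\<in>{1..N}. P i \<ge> 0 \<and> Q i \<ge> 0"
  shows "(mono_on {1..N} P \<and> mono_on {1..N} Q \<longrightarrow>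
            (\<forall>l m n. vertex_T R N P Q C l m n = rec_T R P Q C N l m n)) \<and>
         (P (N + 1) \<ge> 0 \<and> Q (N + 1) \<ge> 0 \<and>
            (\<forall>i\<in>{1..N + 1}. \<forall>j\<in>{1..N + 1}. (P i - P j) * (Q i - Q j) \<ge> 0) \<longrightarrow>
            (let T = vertex_op R (P (N + 1)) (Q (N + 1)) (C (N + 1)) (vertex_T R N) P Q C in
             \<forall>l m n. T l (m + 1) n + T (l + 1) m (n + 1) =
               max (T (l + 1) m n + T l (m + 1) (n + 1) - 2 * R n)
                   (T l m (n + 1) + T (l + 1) (m + 1) n)))"
proof (intro conjI impI allI)
  fix l m n
  assume *: "mono_on {1..N} P \<and> mono_on {1..N} Q"
  have "(P i - P j) * (Q i - Q j) \<ge> 0" if "i \<in> {1..N}" "j \<in> {1..N}" for i j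
    using * that by (cases "i \<le> j") (auto simp: monotone_on_def mult_nonneg_nonneg mult_nonpos_nonpos)
  then have "mono_along (P + Q) {1..N} P" "mono_along (P + Q) {1..N} Q"
    by (rule comonotone_imp_mono_along; blast)+
  with * show "vertex_T R N P Q C l m n = rec_T R P Q C N l m n"
    by (simp add: vertex_T_eq_tau_set rec_T_eq_tau_set)
next
  assume *: "P (N + 1) \<ge> 0 \<and> Q (N + 1) \<ge> 0 \<and>
    (\<forall>i\<in>{1..N + 1}. \<forall>j\<in>{1..N + 1}. (P i - P j) * (Q i - Q j) \<ge> 0)"
  then have "\<forall>i\<in>{1..N + 1}. P i \<ge> 0 \<and> Q i \<ge> 0"
    using assms(2) by (auto simp: le_Suc_eq)
  moreover have "mono_along (P + Q) {1..N + 1} P" "mono_along (P + Q) {1..N + 1} Q"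
    using * comonotone_imp_mono_along[of "{1..N + 1}" P Q] by blast+
  \<comment> \<open>By definition this \<open>T\<close> is
    \<open>vertex_T R (N + 1)\<close>.\<close>
  ultimately show "let T = vertex_op R (P (N + 1)) (Q (N + 1)) (C (N + 1)) (vertex_T R N) P Q C in
      \<forall>l m n. T l (m + 1) n + T (l + 1) m (n + 1) =
        max (T (l + 1) m n + T l (m + 1) (n + 1) - 2 * R n)
            (T l m (n + 1) + T (l + 1) (m + 1) n)"
    using vertex_T_bilinear[of R "N + 1" P Q C] assms(1) by (simp add: Let_def)
qed

end
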